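(* Let $n\ge 3$ and $b\ge 2$, and let $\mathcal{R}[B]$ be the principal submatrix of $\mathcal{R}=\mathcal{R}(T_n^{(b)})$ corresponding to the set of base vertices $B$. The eigenvalues of $\mathcal{R}[B]$ are: $-(n-2)(n-6)b$ with multiplicity $1$; $(n-2)(n-6)b$ with multiplicity $b$; and $(n-2)(n-4)b$ with multiplicity $b-1$.
   Context: Let $n\ge 3$, $b\ge 2$. $I_m$ is the identity matrix of order $m$, $J_{p\times q}$ is the $p\times q$ all-ones matrix, $J_m=J_{m\times m}$, $\mathbf{1}_m$ is the all-ones column vector of length $m$, and $\mathcal{A}_2=\begin{bmatrix}0&1\\1&0\end{bmatrix}$. For a matrix $A$ and index set $S$, $A[S]$ denotes the principal submatrix of $A$ with rows and columns indexed by $S$. Graph and indexing (motivation for the index sets). $T_n$ is the graph on $n$ vertices formed by $n-2$ triangles sharing a common base edge; $T_n^{(b)}$ is obtained from $b$ copies of $T_n$ by identifying one non-base vertex of each copy into a central cut vertex $c$. Its vertices are $1,\dots,b(n-1)+1$ with $c=b(n-1)+1$; in the $k$-th block the vertices $(k-1)(n-1)+i$ with $i=1,2$ are the base vertices and those with $3\le i\le n-1$ are the non-base vertices other than $c$. The set of base vertices is $$B=\{(k-1)(n-1)+i : k=1,\dots,b,\ i=1,2\}.$$ The matrix $\mathcal{R}(T_n^{(b)})$ is the symmetric $(b+1)\times(b+1)$ block matrix of order $b(n-1)+1$ (first $b$ block-rows and block-columns of size $n-1$, last one of size $1$) whose first $b$ diagonal blocks are $\mathcal{R}_1$, whose off-diagonal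 $(i,j)$ blocks with $1\le i\neq j\le b$ are $\mathcal{R}_2$, whose $(i,b+1)$ blocks are $\mathbf{r}_3$ and $(b+1,i)$ blocks are $\mathbf{r}_3^t$ for $1\le i\le b$, and whose $(b+1,b+1)$ block is the scalar $r$. If $n=3$: $\mathcal{R}_1=-2(b-1)I_2+(b+2)\mathcal{A}_2$, $\mathcal{R}_2=2J_2$, $\mathbf{r}_3=3b\,\mathbf{1}_2$, $r=-6(b-1)^2$. If $n\ge 4$: $$\mathcal{R}_1=\begin{bmatrix}(n-5)(n-2)(b-1)I_2+(n-2)(b-(n-5))\mathcal{A}_2 & -((n-4)b-2)J_{2\times(n-3)}\\ -((n-4)b-2)J_{(n-3)\times 2} & b(n-6)I_{n-3}+(b-(n-5))J_{n-3}\end{bmatrix},$$ $$\mathcal{R}_2=\begin{bmatrix}-(n-5)(n-2)J_2 & 2J_{2\times(n-3)}\\ 2J_{(n-3)\times 2} & -(n-5)J_{n-3}\end{bmatrix},\qquad \mathbf{r}_3=\begin{bmatrix}(n-6)[(n-4)b-(n-3)]\mathbf{1}_2\\ -b(n-6)\mathbf{1}_{n-3}\end{bmatrix},$$ $$r=-(n-5)(n-6)(b-1)^2.$$ Multiplicities of listed values are to be added whenever listed values coincide (i.e. the list describes the roots of the characteristic polynomial). *)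

theory Defs
  imports
    "HOL-Computational_Algebra.Polynomial"
    "Jordan_Normal_Form.Char_Poly"
    "Jordan_Normal_Form.DL_Submatrix"
begin

definition ones_mat :: "nat \<Rightarrow> nat \<Rightarrow> real mat" where
  "ones_mat p q = mat p q (\<lambda>_. 1)"

definition ones_vec :: "nat \<Rightarrow> real vec" where
  "ones_vec m = vec m (\<lambda>_. 1)"

definition A2 :: "real mat" where
  "A2 = mat_of_rows_list 2 [[0, 1], [1, 0]]"

text \<open>
  \<open>T_n\<close> consists of \<open>n - 2\<close> triangles sharing a base edge, and \<open>T_n^(b)\<close> of \<open>b\<close> copies of \<open>T_n\<close>
  glued at a non-base vertex \<open>c\<close>. Its vertices are numbered \<open>1, \<dots>, b (n - 1) + 1\<close>, with \<open>c\<close> last;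
  the \<open>k\<close>-th block (\<open>k = 1, \<dots>, b\<close>) consists of the vertices \<open>(k - 1) (n - 1) + i\<close>, of which
  \<open>i = 1, 2\<close> are the base vertices.
\<close>

definition block_diag :: "nat \<Rightarrow> nat \<Rightarrow> real mat" where
  "block_diag n b =
    (if n = 3
     then (- 2 * (real b - 1)) \<cdot>\<^sub>m 1\<^sub>m 2 + (real b + 2) \<cdot>\<^sub>m A2
     else four_block_mat
       (((real n - 5) * (real n - 2) * (real b - 1)) \<cdot>\<^sub>m 1\<^sub>m 2
          + ((real n - 2) * (real b - (real n - 5))) \<cdot>\<^sub>m A2)
       ((- ((real n - 4) * real b - 2)) \<cdot>\<^sub>m ones_mat 2 (n - 3))
       ((- ((real n - 4) * real b - 2)) \<cdot>\<^sub>m ones_mat (n - 3) 2)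
       ((real b * (real n - 6)) \<cdot>\<^sub>m 1\<^sub>m (n - 3)
          + (real b - (real n - 5)) \<cdot>\<^sub>m ones_mat (n - 3) (n - 3)))"

definition block_off :: "nat \<Rightarrow> real mat" where
  "block_off n =
    (if n = 3
     then 2 \<cdot>\<^sub>m ones_mat 2 2
     else four_block_mat
       ((- ((real n - 5) * (real n - 2))) \<cdot>\<^sub>m ones_mat 2 2)
       (2 \<cdot>\<^sub>m ones_mat 2 (n - 3))
       (2 \<cdot>\<^sub>m ones_mat (n - 3) 2)
       ((- (real n - 5)) \<cdot>\<^sub>m ones_mat (n - 3) (n - 3)))"

definition block_cut :: "nat \<Rightarrow> nat \<Rightarrow> real vec" where
  "block_cut n b =
    (if n = 3
     then (3 * real b) \<cdot>\<^sub>v ones_vec 2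
     else (((real n - 6) * ((real n - 4) * real b - (real n - 3))) \<cdot>\<^sub>v ones_vec 2)
       @\<^sub>v ((- (real b * (real n - 6))) \<cdot>\<^sub>v ones_vec (n - 3)))"

definition cut_entry :: "nat \<Rightarrow> nat \<Rightarrow> real" where
  "cut_entry n b =
    (if n = 3
     then - 6 * (real b - 1)\<^sup>2
     else - ((real n - 5) * (real n - 6) * (real b - 1)\<^sup>2))"

text \<open>
  The matrix \<open>\<R>(T_n^(b))\<close>. Matrix indices start at 0, so index \<open>i\<close> stands for vertex \<open>i + 1\<close>:
  for \<open>i < b (n - 1)\<close> the block number is \<open>i div (n - 1)\<close> and the position inside the block is
  \<open>i mod (n - 1)\<close>, and \<open>i = b (n - 1)\<close> is the cut vertex.
\<close>

definition R_mat :: "nat \<Rightarrow> nat \<Rightarrow> real mat" where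
  "R_mat n b = mat (b * (n - 1) + 1) (b * (n - 1) + 1) (\<lambda>(i, j).
     if i < b * (n - 1) \<and> j < b * (n - 1) then
       (if i div (n - 1) = j div (n - 1)
        then block_diag n b $$ (i mod (n - 1), j mod (n - 1))
        else block_off n $$ (i mod (n - 1), j mod (n - 1)))
     else if i < b * (n - 1) then block_cut n b $ (i mod (n - 1))
     else if j < b * (n - 1) then block_cut n b $ (j mod (n - 1))
     else cut_entry n b)"

definition base_vertices :: "nat \<Rightarrow> nat \<Rightarrow> nat set" where
  "base_vertices n b = {(k - 1) * (n - 1) + i | k i. k \<in> {1..b} \<and> i \<in> {1, 2}}"

text \<open>\<open>A[S]\<close> for a set \<open>S\<close> of positions counted from 1; the library's \<open>submatrix\<close> counts from 0.\<close>

definition principal_submatrix :: "'a mat \<Rightarrow> nat set \<Rightarrow> 'a mat" where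
  "principal_submatrix A S = submatrix A ((\<lambda>v. v - 1) ` S) ((\<lambda>v. v - 1) ` S)"

text \<open>The eigenvalues with algebraic multiplicity, i.e. the roots (in the coefficient field) of the
  characteristic polynomial.\<close>

definition eigenvalues_mset :: "'a :: idom mat \<Rightarrow> 'a multiset" where
  "eigenvalues_mset A = proots (char_poly A)"

end

theory Submission
  imports Defs
begin

text \<open>
  On the base vertices the case distinction \<open>n = 3\<close> versus \<open>n \<ge> 4\<close> disappears: \<open>\<R>[B]\<close> has the
  entry \<open>\<alpha> = (n - 5) (n - 2) (b - 1)\<close> on the diagonal, \<open>\<beta> = (n - 2) (b - (n - 5))\<close> between the two
  base vertices of one block, and \<open>\<gamma> = - (n - 5) (n - 2)\<close> between base vertices of different blocks.

  Let \<open>C\<close> be the \<open>2b \<times> b\<close> incidence matrix of vertices and blocks. Then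
  \<open>\<R>[B] = (\<alpha> - \<beta>) I + C K C\<^sup>t\<close> with \<open>K = (\<beta> - \<gamma>) I + \<gamma> J\<close>. Apart from the multiplicity of \<open>0\<close>, the
  product \<open>C (K C\<^sup>t)\<close> has the spectrum of \<open>(K C\<^sup>t) C = 2 K\<close>, because both
  characteristic polynomials come from one block determinant, once by column and once by row
  elimination (\<open>det_smult_one_minus_mult_swap\<close>).
  The same principle reduces \<open>\<gamma> J = (\<gamma> \<one>) \<one>\<^sup>t\<close> to a \<open>1 \<times> 1\<close> matrix. Hence the eigenvalues are
  \<open>\<alpha> - \<beta>\<close> (\<open>b\<close> times, vectors antisymmetric in each block), \<open>\<alpha> + \<beta> - 2 \<gamma>\<close> (\<open>b - 1\<close> times,
  vectors constant on blocks with sum zero) and \<open>\<alpha> + \<beta> + 2 (b - 1) \<gamma>\<close> (once, the vector \<open>\<one>\<close>),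
  which are the three listed values.
\<close>

section \<open>Determinants of multiples of the identity perturbed by products\<close>

text \<open>
  Both sides are \<open>t ^ n\<close> times the determinant of \<open>[t I, A; B, I]\<close>: multiplying this matrix
  on the right by \<open>[I, 0; -B, I]\<close> clears the lower left block, multiplying on the left by \<open>[I, 0; -B, t I]\<close> clears
  the same block but costs a factor \<open>t ^ n\<close>.
\<close>

lemma det_smult_one_minus_mult_swap:
  fixes A B :: "'a :: idom mat"
  assumes A: "A \<in> carrier_mat m n" and B: "B \<in> carrier_mat n m"
  shows "t ^ n * det (t \<cdot>\<^sub>m 1\<^sub>m m - A * B) = t ^ m * det (t \<cdot>\<^sub>m 1\<^sub>m n - B * A)"
proof -
  let ?F = "four_block_mat (t \<cdot>\<^sub>m 1\<^sub>m m) A B (1\<^sub>m n)"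
  let ?R = "four_block_mat (1\<^sub>m m) (0\<^sub>m m n) (- B) (1\<^sub>m n)"
  let ?L = "four_block_mat (1\<^sub>m m) (0\<^sub>m m n) (- B) (t \<cdot>\<^sub>m 1\<^sub>m n)"
  have AB: "A * B \<in> carrier_mat m m" and BA: "B * A \<in> carrier_mat n n"
    using A B by auto
  have F: "?F \<in> carrier_mat (m + n) (m + n)"
    and R: "?R \<in> carrier_mat (m + n) (m + n)"
    and L: "?L \<in> carrier_mat (m + n) (m + n)"
    by (auto intro!: four_block_carrier_mat)
  note carrier = A B one_carrier_mat zero_carrier_mat smult_carrier_mat uminus_carrier_mat
  have r1: "t \<cdot>\<^sub>m 1\<^sub>m m * 1\<^sub>m m + A * (- B) = t \<cdot>\<^sub>m 1\<^sub>m m - A * B"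
    using A B AB by (simp add: add_uminus_minus_mat[where nr = m and nc = m])
  have r2: "t \<cdot>\<^sub>m 1\<^sub>m m * 0\<^sub>m m n + A * 1\<^sub>m n = A"
    and r3: "B * 1\<^sub>m m + 1\<^sub>m n * (- B) = 0\<^sub>m n m"
    and r4: "B * 0\<^sub>m m n + 1\<^sub>m n * 1\<^sub>m n = (1\<^sub>m n :: 'a mat)"
    using A B by (simp_all add: add_uminus_minus_mat[where nr = n and nc = m] minus_r_inv_mat)
  have FR: "?F * ?R = four_block_mat (t \<cdot>\<^sub>m 1\<^sub>m m - A * B) A (0\<^sub>m n m) (1\<^sub>m n)"
    by (subst mult_four_block_mat[where ?nr1.0 = m and ?nr2.0 = n and ?n1.0 = m and ?n2.0 = n
          and ?nc1.0 = m and ?nc2.0 = n])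
      (intro carrier | simp only: r1 r2 r3 r4)+
  have l1: "1\<^sub>m m * (t \<cdot>\<^sub>m 1\<^sub>m m) + 0\<^sub>m m n * B = t \<cdot>\<^sub>m 1\<^sub>m m"
    and l2: "1\<^sub>m m * A + 0\<^sub>m m n * 1\<^sub>m n = A"
    using A B by simp_all
  have "B * (t \<cdot>\<^sub>m 1\<^sub>m m) = t \<cdot>\<^sub>m B"
    using mult_smult_distrib[of B n m "1\<^sub>m m" m t] B by simp
  moreover have "t \<cdot>\<^sub>m 1\<^sub>m n * B = t \<cdot>\<^sub>m B"
    using mult_smult_assoc_mat[of "1\<^sub>m n" n n B m t] B by simp
  ultimately have l3: "- B * (t \<cdot>\<^sub>m 1\<^sub>m m) + t \<cdot>\<^sub>m 1\<^sub>m n * B = 0\<^sub>m n m"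
    using B uminus_l_inv_mat[of "t \<cdot>\<^sub>m B" n m] by simp
  have l4: "- B * A + t \<cdot>\<^sub>m 1\<^sub>m n * 1\<^sub>m n = t \<cdot>\<^sub>m 1\<^sub>m n - B * A"
    using A B BA
    by (simp add: comm_add_mat[of "- (B * A)" n n]
        add_uminus_minus_mat[where nr = n and nc = n])
  have LF: "?L * ?F = four_block_mat (t \<cdot>\<^sub>m 1\<^sub>m m) A (0\<^sub>m n m) (t \<cdot>\<^sub>m 1\<^sub>m n - B * A)"
    by (subst mult_four_block_mat[where ?nr1.0 = m and ?nr2.0 = n and ?n1.0 = m and ?n2.0 = n
          and ?nc1.0 = m and ?nc2.0 = n])
      (intro carrier | simp only: l1 l2 l3 l4)+
  have "det ?F * det ?R = det (?F * ?R)"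
    by (rule det_mult[OF F R, symmetric])
  also have "\<dots> = det (t \<cdot>\<^sub>m 1\<^sub>m m - A * B) * det (1\<^sub>m n :: 'a mat)"
    unfolding FR using A minus_carrier_mat[OF AB]
    by (intro det_four_block_mat_lower_left_zero[where n = m and m = n]) simp_all
  finally have "det ?F * det ?R = det (t \<cdot>\<^sub>m 1\<^sub>m m - A * B) * det (1\<^sub>m n :: 'a mat)" .
  moreover have "det ?R = det (1\<^sub>m m :: 'a mat) * det (1\<^sub>m n :: 'a mat)"
    by (rule det_four_block_mat_upper_right_zero[where n = m and m = n]) (use B in auto)
  ultimately have 1: "det ?F = det (t \<cdot>\<^sub>m 1\<^sub>m m - A * B)"
    by simp
  have "det ?L * det ?F = det (?L * ?F)"
    by (rule det_mult[OF L F, symmetric])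
  also have "\<dots> = det (t \<cdot>\<^sub>m 1\<^sub>m m :: 'a mat) * det (t \<cdot>\<^sub>m 1\<^sub>m n - B * A)"
    unfolding LF using A minus_carrier_mat[OF BA]
    by (intro det_four_block_mat_lower_left_zero[where n = m and m = n]) simp_all
  finally have "det ?L * det ?F = det (t \<cdot>\<^sub>m 1\<^sub>m m :: 'a mat) * det (t \<cdot>\<^sub>m 1\<^sub>m n - B * A)" .
  moreover have "det ?L = det (1\<^sub>m m :: 'a mat) * det (t \<cdot>\<^sub>m 1\<^sub>m n :: 'a mat)"
    by (rule det_four_block_mat_upper_right_zero[where n = m and m = n]) (use B in auto)
  ultimately show ?thesis
    by (simp add: 1)
qed

text \<open>The matrix is \<open>s I + c J\<close>, and \<open>J\<close> is a product through dimension 1.\<close>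

lemma det_identity_plus_constant:
  fixes s c :: "'a :: idom"
  assumes "s \<noteq> 0" and "b > 0"
  shows "det (mat b b (\<lambda>(i, j). if i = j then s + c else c)) = s ^ (b - 1) * (s + of_nat b * c)"
proof -
  let ?M = "mat b b (\<lambda>(i, j). if i = j then s + c else c)"
  let ?A = "mat b 1 (\<lambda>_. - c)" and ?B = "mat 1 b (\<lambda>_. 1 :: 'a)"
  have "s \<cdot>\<^sub>m 1\<^sub>m b - ?A * ?B = ?M"
    by (rule eq_matI) (auto simp: scalar_prod_def)
  moreover have "det (s \<cdot>\<^sub>m 1\<^sub>m 1 - ?B * ?A) = s + of_nat b * c"
    by (subst det_single) (auto simp: scalar_prod_def)
  ultimately have "s * det ?M = s ^ b * (s + of_nat b * c)"
    using det_smult_one_minus_mult_swap[of ?A b 1 ?B s] by simp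
  also have "s ^ b = s * s ^ (b - 1)"
    using \<open>b > 0\<close> by (cases b) auto
  finally show ?thesis
    using \<open>s \<noteq> 0\<close> by simp
qed

lemma card_div_eq:
  fixes k :: nat
  assumes "m > 0" and "k < b"
  shows "card {j. j < b * m \<and> j div m = k} = m"
proof -
  have "Suc k * m \<le> b * m"
    using \<open>k < b\<close> by (intro mult_le_mono1) simp
  hence "{j. j < b * m \<and> j div m = k} = {k * m ..< k * m + m}"
    using dividend_less_div_times[OF \<open>m > 0\<close>] div_times_less_eq_dividend[of _ m]
    by (auto simp: mult.commute add.commute intro: div_nat_eqI)
  thus ?thesis by simp
qed

text \<open>
  The matrix is \<open>t I + C (d I + c J) C\<^sup>t\<close> for the incidence matrix \<open>C\<close> of \<open>b m\<close> indices and \<open>b\<close>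
  consecutive blocks of length \<open>m\<close>; swapping the factors uses \<open>C\<^sup>t C = m I\<close>.
\<close>

lemma det_identity_plus_blockwise_constant:
  fixes t d c :: "'a :: idom"
  assumes t: "t \<noteq> 0" and s: "t + of_nat m * d \<noteq> 0" and m: "m > 0" and b: "b > 0"
  shows "det (mat (b * m) (b * m) (\<lambda>(i, j).
        if i = j then t + d + c else if i div m = j div m then d + c else c)) =
      t ^ (b * (m - 1)) * (t + of_nat m * d) ^ (b - 1) * (t + of_nat m * (d + of_nat b * c))"
proof -
  let ?M = "mat (b * m) (b * m) (\<lambda>(i, j).
        if i = j then t + d + c else if i div m = j div m then d + c else c)"
  let ?A = "mat (b * m) b (\<lambda>(i, k). if i div m = k then - 1 else 0 :: 'a)"
  let ?B = "mat b (b * m) (\<lambda>(k, j). if j div m = k then d + c else c)"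
  have "t \<cdot>\<^sub>m 1\<^sub>m (b * m) - ?A * ?B = ?M"
  proof (rule eq_matI, goal_cases)
    case (1 i j)
    hence ij: "i < b * m" "j < b * m" by auto
    hence "i div m < b"
      by (simp add: less_mult_imp_div_less)
    have "(?A * ?B) $$ (i, j) =
        (\<Sum>k = 0..<b. (if i div m = k then - 1 else 0) * (if j div m = k then d + c else c))"
      using ij by (simp add: scalar_prod_def)
    also have "\<dots> = (\<Sum>k = 0..<b. if i div m = k then - (if j div m = k then d + c else c) else 0)"
      by (rule sum.cong) auto
    also have "\<dots> = - (if j div m = i div m then d + c else c)"
      using \<open>i div m < b\<close> by simp
    finally show ?case
      using ij by auto
  qed auto
  moreover have "t \<cdot>\<^sub>m 1\<^sub>m b - ?B * ?A =
      mat b b (\<lambda>(k, l). if k = l then (t + of_nat m * d) + of_nat m * c else of_nat m * c)"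
  proof (rule eq_matI, goal_cases)
    case (1 k l)
    hence kl: "k < b" "l < b" by auto
    have "(?B * ?A) $$ (k, l) =
        (\<Sum>j = 0..<b * m. if j div m = l then - (if l = k then d + c else c) else 0)"
      using kl by (auto simp: scalar_prod_def intro!: sum.cong)
    also have "\<dots> = (\<Sum>j \<in> {j. j < b * m \<and> j div m = l}. - (if l = k then d + c else c))"
      by (rule sum.mono_neutral_cong_right) auto
    also have "\<dots> = - (of_nat m * (if l = k then d + c else c))"
      using card_div_eq[OF m kl(2)] by simp
    finally show ?case
      using kl by (auto simp: algebra_simps)
  qed auto
  ultimately have "t ^ b * det ?M =
      t ^ (b * m) * ((t + of_nat m * d) ^ (b - 1) * (t + of_nat m * d + of_nat b * (of_nat m * c)))"
    using det_smult_one_minus_mult_swap[of ?A "b * m" b ?B t]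
      det_identity_plus_constant[OF s b, of "of_nat m * c"] by simp
  also have "t ^ (b * m) = t ^ b * t ^ (b * (m - 1))"
    using m by (cases m) (auto simp: power_add)
  finally have "t ^ b * det ?M = t ^ b * (t ^ (b * (m - 1)) * (t + of_nat m * d) ^ (b - 1)
      * (t + of_nat m * (d + of_nat b * c)))"
    by (simp only: algebra_simps)
  thus ?thesis
    using t by simp
qed

section \<open>Spectrum of a matrix with constant blocks and constant diagonal\<close>

text \<open>
  The previous determinant in the polynomial ring, with \<open>t = x - (\<alpha> - \<beta>)\<close>, \<open>d = - (\<beta> - \<gamma>)\<close> and
  \<open>c = - \<gamma>\<close>; \<open>t\<close> and \<open>t + m d\<close> are monic of degree 1, hence nonzero.
\<close>

lemma eigenvalues_blockwise_constant:
  fixes \<alpha> \<beta> \<gamma> :: "'a :: idom"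
  assumes m: "m > 0" and b: "b > 0"
  shows "eigenvalues_mset (mat (b * m) (b * m) (\<lambda>(i, j).
        if i = j then \<alpha> else if i div m = j div m then \<beta> else \<gamma>)) =
      replicate_mset (b * (m - 1)) (\<alpha> - \<beta>)
      + replicate_mset (b - 1) (\<alpha> - \<beta> + of_nat m * (\<beta> - \<gamma>))
      + {# \<alpha> - \<beta> + of_nat m * (\<beta> - \<gamma> + of_nat b * \<gamma>) #}"
proof -
  let ?M = "mat (b * m) (b * m) (\<lambda>(i, j). if i = j then \<alpha> else if i div m = j div m then \<beta> else \<gamma>)"
  define t d c where "t = [:- (\<alpha> - \<beta>), 1:]" and "d = [:- (\<beta> - \<gamma>):]" and "c = [:- \<gamma>:]"
  have s: "t + of_nat m * d = [:- (\<alpha> - \<beta> + of_nat m * (\<beta> - \<gamma>)), 1:]"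
    by (simp add: t_def d_def of_nat_poly algebra_simps)
  have r: "t + of_nat m * (d + of_nat b * c) =
      [:- (\<alpha> - \<beta> + of_nat m * (\<beta> - \<gamma> + of_nat b * \<gamma>)), 1:]"
    by (simp add: t_def d_def c_def of_nat_poly algebra_simps)
  have roots: "proots ([:- u, 1:] ^ p * [:- v, 1:] ^ q * [:- w, 1:]) =
      replicate_mset p u + replicate_mset q v + {# w #}" for u v w :: 'a and p q
    by (simp add: proots_mult proots_power del: mult_pCons_left mult_pCons_right)
  have "char_poly_matrix ?M = mat (b * m) (b * m) (\<lambda>(i, j).
      if i = j then t + d + c else if i div m = j div m then d + c else c)"
    by (rule eq_matI) (auto simp: char_poly_matrix_def t_def d_def c_def)
  hence "char_poly ?M = t ^ (b * (m - 1)) * (t + of_nat m * d) ^ (b - 1)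
      * (t + of_nat m * (d + of_nat b * c))"
    unfolding char_poly_def
    using det_identity_plus_blockwise_constant[OF _ _ m b, of t d c] s by (simp add: t_def)
  also have "proots \<dots> = replicate_mset (b * (m - 1)) (\<alpha> - \<beta>)
      + replicate_mset (b - 1) (\<alpha> - \<beta> + of_nat m * (\<beta> - \<gamma>))
      + {# \<alpha> - \<beta> + of_nat m * (\<beta> - \<gamma> + of_nat b * \<gamma>) #}"
    unfolding s r unfolding t_def by (rule roots)
  finally show ?thesis
    by (simp add: eigenvalues_mset_def)
qed

section \<open>The principal submatrix on the base vertices\<close>

lemma pick_strict_mono_image:
  fixes f :: "nat \<Rightarrow> nat"
  assumes f: "strict_mono_on {..<N} f" and "i < N"
  shows "pick (f ` {..<N}) i = f i"
proof -
  have inj: "inj_on f {..<N}"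
    using f by (rule strict_mono_on_imp_inj_on)
  have "{a \<in> f ` {..<N}. a < f i} = f ` {..<i}"
    using \<open>i < N\<close> strict_mono_on_less[OF f] by auto
  hence "card {a \<in> f ` {..<N}. a < f i} = i"
    using inj \<open>i < N\<close> by (simp add: card_image inj_on_subset)
  thus ?thesis
    using pick_card_in_set[of "f i" "f ` {..<N}"] \<open>i < N\<close> by auto
qed

lemma submatrix_strict_mono_image:
  fixes f :: "nat \<Rightarrow> nat"
  assumes A: "A \<in> carrier_mat M M" and f: "strict_mono_on {..<N} f"
    and le: "\<And>i. i < N \<Longrightarrow> f i < M"
  shows "submatrix A (f ` {..<N}) (f ` {..<N}) = mat N N (\<lambda>(i, j). A $$ (f i, f j))"
proof -
  have "{i. i < M \<and> i \<in> f ` {..<N}} = f ` {..<N}"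
    using le by auto
  moreover have "card (f ` {..<N}) = N"
    using strict_mono_on_imp_inj_on[OF f] by (simp add: card_image)
  ultimately show ?thesis
    using A unfolding submatrix_def
    by (intro eq_matI) (auto simp: pick_strict_mono_image[OF f])
qed

text \<open>The increasing enumeration of the base vertices; arguments and values are counted from 0.\<close>

definition base_position :: "nat \<Rightarrow> nat \<Rightarrow> nat" where
  "base_position n i = (i div 2) * (n - 1) + i mod 2"

lemma strict_mono_base_position:
  assumes "n \<ge> 3"
  shows "strict_mono (base_position n)"
  unfolding strict_mono_Suc_iff
proof
  fix i
  show "base_position n i < base_position n (Suc i)"
    using assms by (cases "even i") (auto simp: base_position_def elim!: evenE oddE)
qed

lemma base_position_div_mod:
  assumes "n \<ge> 3"
  shows "base_position n i div (n - 1) = i div 2" and "base_position n i mod (n - 1) = i mod 2"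
proof -
  have "i mod 2 < n - 1"
    using assms by (auto intro: less_le_trans[of _ 2])
  thus "base_position n i div (n - 1) = i div 2" and "base_position n i mod (n - 1) = i mod 2"
    by (simp_all add: base_position_def)
qed

lemma base_position_less:
  assumes "n \<ge> 3" and "i < b * 2"
  shows "base_position n i < b * (n - 1)"
proof -
  have "base_position n i div (n - 1) < b"
    unfolding base_position_div_mod(1)[OF assms(1)] using assms(2) by (rule less_mult_imp_div_less)
  thus ?thesis
    using assms(1) by (simp add: div_less_iff_less_mult)
qed

lemma base_vertices_eq_image:
  assumes "n \<ge> 3"
  shows "(\<lambda>v. v - 1) ` base_vertices n b = base_position n ` {..<b * 2}" (is "?L = ?R")
proof
  show "?L \<subseteq> ?R"
  proof
    fix x assume "x \<in> ?L"
    then obtain k i where ki: "k \<in> {1..b}" "i \<in> {1, 2}" "x = (k - 1) * (n - 1) + i - 1"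
      by (auto simp: base_vertices_def)
    hence "x = base_position n ((k - 1) * 2 + (i - 1))" "(k - 1) * 2 + (i - 1) < b * 2"
      by (auto simp: base_position_def)
    thus "x \<in> ?R" by blast
  qed
  show "?R \<subseteq> ?L"
  proof
    fix x assume "x \<in> ?R"
    then obtain j where j: "j < b * 2" "x = base_position n j" by auto
    have "(j div 2) * (n - 1) + (j mod 2 + 1) \<in> base_vertices n b"
      unfolding base_vertices_def using j(1)
      by (intro CollectI exI[of _ "j div 2 + 1"] exI[of _ "j mod 2 + 1"]) auto
    thus "x \<in> ?L"
      using j(2) by (force simp: base_position_def)
  qed
qed

text \<open>For \<open>n = 3\<close> the entries given separately agree with the formulas for \<open>n \<ge> 4\<close>.\<close>

lemma R_mat_base_position:
  assumes n: "n \<ge> 3" and ij: "i < b * 2" "j < b * 2"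
  shows "R_mat n b $$ (base_position n i, base_position n j) =
      (if i = j then (real n - 5) * (real n - 2) * (real b - 1)
       else if i div 2 = j div 2 then (real n - 2) * (real b - (real n - 5))
       else - ((real n - 5) * (real n - 2)))"
proof -
  note less = base_position_less[OF n ij(1)] base_position_less[OF n ij(2)]
  have two: "k < 2 \<longleftrightarrow> k = 0 \<or> k = 1" for k :: nat
    by auto
  have diag: "block_diag n b $$ (p, q) =
      (if p = q then (real n - 5) * (real n - 2) * (real b - 1)
       else (real n - 2) * (real b - (real n - 5)))" if "p < 2" "q < 2" for p q
    using n that by (auto simp: block_diag_def A2_def mat_of_rows_list_def two)
  have off: "block_off n $$ (p, q) = - ((real n - 5) * (real n - 2))" if "p < 2" "q < 2" for p q
    using n that by (auto simp: block_off_def ones_mat_def)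
  have "i = j \<longleftrightarrow> i div 2 = j div 2 \<and> i mod 2 = j mod 2"
    by (metis div_mult_mod_eq)
  thus ?thesis
    using less by (simp add: R_mat_def base_position_div_mod[OF n, simplified] diag off)
qed

lemma principal_submatrix_base_vertices:
  assumes "n \<ge> 3"
  shows "principal_submatrix (R_mat n b) (base_vertices n b) = mat (b * 2) (b * 2) (\<lambda>(i, j).
      if i = j then (real n - 5) * (real n - 2) * (real b - 1)
      else if i div 2 = j div 2 then (real n - 2) * (real b - (real n - 5))
      else - ((real n - 5) * (real n - 2)))"
proof -
  have "R_mat n b \<in> carrier_mat (b * (n - 1) + 1) (b * (n - 1) + 1)"
    by (simp add: R_mat_def)
  moreover have "base_position n i < b * (n - 1) + 1" if "i < b * 2" for i
    using base_position_less[OF assms that] by simp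
  moreover have "strict_mono_on {..<b * 2} (base_position n)"
    using strict_mono_base_position[OF assms] by (auto simp: strict_mono_on_def strict_mono_def)
  ultimately show ?thesis
    unfolding principal_submatrix_def base_vertices_eq_image[OF assms]
    by (subst submatrix_strict_mono_image)
      (auto simp: R_mat_base_position[OF assms] intro!: eq_matI)
qed

theorem theorem4p2:
  fixes n b :: nat
  assumes "n \<ge> 3" and "b \<ge> 2"
  shows "eigenvalues_mset (principal_submatrix (R_mat n b) (base_vertices n b)) =
      {# - ((real n - 2) * (real n - 6) * real b) #}
      + replicate_mset b ((real n - 2) * (real n - 6) * real b)
      + replicate_mset (b - 1) ((real n - 2) * (real n - 4) * real b)"
proof -
  define \<alpha> \<beta> \<gamma> where "\<alpha> = (real n - 5) * (real n - 2) * (real b - 1)"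
    and "\<beta> = (real n - 2) * (real b - (real n - 5))"
    and "\<gamma> = - ((real n - 5) * (real n - 2))"
  have "\<alpha> - \<beta> = (real n - 2) * (real n - 6) * real b"
    and "\<alpha> - \<beta> + real 2 * (\<beta> - \<gamma>) = (real n - 2) * (real n - 4) * real b"
    and "\<alpha> - \<beta> + real 2 * (\<beta> - \<gamma> + real b * \<gamma>) = - ((real n - 2) * (real n - 6) * real b)"
    by (simp_all add: \<alpha>_def \<beta>_def \<gamma>_def algebra_simps)
  thus ?thesis
    using eigenvalues_blockwise_constant[of 2 b \<alpha> \<beta> \<gamma>] assms
    unfolding principal_submatrix_base_vertices[OF assms(1)] \<alpha>_def[symmetric] \<beta>_def[symmetric]
      \<gamma>_def[symmetric]
    by simp
qed

end
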